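(* Let $F$ be a field of characteristic not $2$ which is square root closed, that is, $F=F^2$ (every element of $F$ is a square in $F$), and let $R$ be a unital commutative associative $F$-algebra which is a unique factorization domain. Let $Z=\begin{pmatrix}Z_1&Z_2\\Z_3&-Z_1\end{pmatrix}$ be a nonzero element of $\mathfrak{sl}_2(R)$. Then the following two conditions are equivalent. (1) There is a subalgebra ${\mathfrak a}$ of $\mathfrak{sl}_2(R)$ such that $Z\in{\mathfrak a}$ and ${\mathfrak a}\simeq\mathfrak{sl}_2(F)$. (2) If $Z_1^2+Z_2Z_3=0$, then $(Z_2)+(Z_3)=R$; otherwise $Z_1^2+Z_2Z_3\in F^\times$.
   Context: For a commutative $F$-algebra $A$, $\mathfrak{sl}_2(A)$ denotes the set of $2\times 2$ matrices $\begin{pmatrix}a&b\\c&-a\end{pmatrix}$ with $a,b,c\in A$, viewed as a Lie algebra over $F$ under the commutator bracket. Subalgebras are $F$-Lie subalgebras and $\simeq$ denotes isomorphism of Lie algebras over $F$. $F$ is identified with its image in $R$, and $F^\times=F\setminus\{0\}$. For $r\in R$, $(r)$ denotes the principal ideal of $R$ generated by $r$. *)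

theory Defs
  imports "HOL-Analysis.Analysis" "HOL-Computational_Algebra.Computational_Algebra"
begin

locale commutative_unital_algebra = vector_space scl
  for scl :: "'f::field \<Rightarrow> 'a::comm_ring_1 \<Rightarrow> 'a" +
  assumes scale_mult_left: "scl c (x * y) = scl c x * y"

definition algebra_embedding :: "('f \<Rightarrow> 'a::comm_ring_1 \<Rightarrow> 'a) \<Rightarrow> 'f \<Rightarrow> 'a" where
  "algebra_embedding scl c = scl c 1"

definition principal_ideal :: "'a::comm_ring_1 \<Rightarrow> 'a set" where
  "principal_ideal r = range (\<lambda>x. r * x)"

definition ideal_sum :: "'a::comm_ring_1 set \<Rightarrow> 'a set \<Rightarrow> 'a set" where
  "ideal_sum I J = {x + y | x y. x \<in> I \<and> y \<in> J}"

definition sl2_matrix :: "'a::comm_ring_1 \<Rightarrow> 'a \<Rightarrow> 'a \<Rightarrow> 'a^2^2" where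
  "sl2_matrix a b c = vector [vector [a, b], vector [c, - a]]"

definition sl2 :: "('a::comm_ring_1^2^2) set" where
  "sl2 = {sl2_matrix a b c | a b c. True}"

definition matrix_scale :: "('f \<Rightarrow> 'a \<Rightarrow> 'a) \<Rightarrow> 'f \<Rightarrow> 'a^'n^'m \<Rightarrow> 'a^'n^'m" where
  "matrix_scale scl c M = (\<chi> i j. scl c (M $ i $ j))"

definition commutator :: "'a::comm_ring_1^'n^'n \<Rightarrow> 'a^'n^'n \<Rightarrow> 'a^'n^'n" where
  "commutator A B = A ** B - B ** A"

text \<open>A Lie algebra is represented by a scalar multiplication and a bracket on the whole type,
  together with the set of its elements.\<close>

definition lie_subalgebra ::
    "('f::field \<Rightarrow> 'v::ab_group_add \<Rightarrow> 'v) \<Rightarrow> ('v \<Rightarrow> 'v \<Rightarrow> 'v) \<Rightarrow> 'v set \<Rightarrow> 'v set \<Rightarrow> bool" where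
  "lie_subalgebra scl bracket S L \<longleftrightarrow>
     S \<subseteq> L \<and> module.subspace scl S \<and> (\<forall>x\<in>S. \<forall>y\<in>S. bracket x y \<in> S)"

definition lie_isomorphic ::
    "('f::field \<Rightarrow> 'v::ab_group_add \<Rightarrow> 'v) \<Rightarrow> ('v \<Rightarrow> 'v \<Rightarrow> 'v) \<Rightarrow> 'v set \<Rightarrow>
     ('f \<Rightarrow> 'w::ab_group_add \<Rightarrow> 'w) \<Rightarrow> ('w \<Rightarrow> 'w \<Rightarrow> 'w) \<Rightarrow> 'w set \<Rightarrow> bool" where
  "lie_isomorphic scl bracket L scl' bracket' L' \<longleftrightarrow>
     (\<exists>f. bij_betw f L L' \<and>
          (\<forall>x\<in>L. \<forall>y\<in>L. f (x + y) = f x + f y) \<and>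
          (\<forall>c. \<forall>x\<in>L. f (scl c x) = scl' c (f x)) \<and>
          (\<forall>x\<in>L. \<forall>y\<in>L. f (bracket x y) = bracket' (f x) (f y)))"

lemma vector_space_matrix_scale:
  assumes "vector_space scl"
  shows "vector_space (matrix_scale scl :: 'f::field \<Rightarrow> 'a::ab_group_add^'n^'m \<Rightarrow> 'a^'n^'m)"
proof -
  interpret vector_space scl by fact
  show ?thesis
    by unfold_locales (simp_all add: matrix_scale_def vec_eq_iff scale_right_distrib scale_left_distrib)
qed

lemma (in commutative_unital_algebra) lie_subalgebra_sl2:
  "lie_subalgebra (matrix_scale scl) commutator (sl2 :: ('a^2^2) set) sl2"
proof -
  interpret M: vector_space "matrix_scale scl :: 'f \<Rightarrow> 'a^2^2 \<Rightarrow> 'a^2^2"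
    by (rule vector_space_matrix_scale) unfold_locales
  have sl2_iff: "A \<in> sl2 \<longleftrightarrow> A $ 2 $ 2 = - A $ 1 $ 1" for A :: "'a^2^2"
    by (auto simp: sl2_def sl2_matrix_def vec_eq_iff forall_2)
  show ?thesis
    by (auto simp: lie_subalgebra_def M.subspace_def sl2_iff matrix_scale_def commutator_def
        matrix_matrix_mult_def sum_2 algebra_simps)
qed

end

theory Submission
  imports Defs
begin

text \<open>
  The proof works in the quadratic module of trace-zero matrices, with the form
  \<open>q(A) = - det A\<close> and its polar form, the trace form \<open>tr(AB)\<close>. Two trace-zero matrices satisfy
  \<open>[A,[A,B]] = 4 q(A) B - 2 tr(AB) A\<close> (\<open>double_commutator\<close>), so the bracket determines the form and
  the form determines which pairs of matrices generate a copy of \<open>sl2(F)\<close>.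

  If \<open>\<phi>\<close> embeds \<open>sl2(F)\<close> into \<open>sl2(R)\<close>, comparing \<open>(ad z)^3 = 4 q(z) ad z\<close> on both sides shows that
  \<open>q(\<phi> z)\<close> is the scalar \<open>q(z)\<close> (\<open>sl2_embedding_quadratic\<close>). This is the whole of the forward
  direction when \<open>q(Z) \<noteq> 0\<close>. When \<open>q(Z) = 0\<close>, over the field there is some \<open>y\<close> with \<open>tr(zy) = 1\<close>; this
  relation can be written with brackets, so it is carried over to \<open>R\<close>, where it reads
  \<open>2 Z1 Y1 + Z2 Y3 + Z3 Y2 = 1\<close>. As \<open>Z1^2 = - Z2 Z3\<close>, the element \<open>2 Z1 Y1\<close> is nilpotent modulo
  \<open>(Z2) + (Z3)\<close>, and it is congruent to 1, so that ideal is \<open>R\<close>.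

  Conversely, two isotropic matrices \<open>E\<close>, \<open>Y\<close> with \<open>tr(EY) = 1\<close> form, together with \<open>[E,Y]\<close>, a standard
  \<open>sl2\<close>-triple, and the \<open>F\<close>-span of the triple is a copy of \<open>sl2(F)\<close>
  (\<open>sl2_embedding_of_hyperbolic_pair\<close>). If \<open>q(Z) = 0\<close> and \<open>(Z2) + (Z3) = R\<close>, a Bezout relation
  gives an isotropic partner of \<open>Z\<close> (\<open>hyperbolic_partner\<close>). If \<open>q(Z)\<close> is a nonzero scalar, it is the
  square of a scalar, and dividing by the root leads to \<open>q(Z) = 1\<close>. Then \<open>(1 + Z)/2\<close> is an
  idempotent of rank one, and unique factorization writes it as a column times a row. In other words,
  \<open>Z\<close> is conjugate to \<open>diag(1,-1)\<close>, and the conjugates of the two elementary nilpotent matrices have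
  \<open>Z\<close> as their bracket (\<open>hyperbolic_pair_of_quadratic_one\<close>).
\<close>

text \<open>Below, \<open>$\<close> only selects components of matrices; the reading as a coefficient of a formal
  power series makes the parsing of nested selections ambiguous.\<close>

no_notation fps_nth (infixl \<open>$\<close> 75)

section \<open>The quadratic form on trace-zero matrices\<close>

text \<open>On trace-zero matrices this is the negative of the determinant, and \<open>A ** A\<close> is the corresponding
  scalar matrix.\<close>

definition sl2_quadratic :: "'a::comm_ring_1^2^2 \<Rightarrow> 'a" where
  "sl2_quadratic A = (A $ 1 $ 1)^2 + A $ 1 $ 2 * A $ 2 $ 1"

text \<open>On trace-zero matrices this is the trace of the product \<open>A ** B\<close>.\<close>

definition sl2_polar :: "'a::comm_ring_1^2^2 \<Rightarrow> 'a^2^2 \<Rightarrow> 'a" where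
  "sl2_polar A B = 2 * A $ 1 $ 1 * B $ 1 $ 1 + A $ 1 $ 2 * B $ 2 $ 1 + A $ 2 $ 1 * B $ 1 $ 2"

lemma sl2_matrix_nth [simp]:
  "sl2_matrix a b c $ 1 $ 1 = a" "sl2_matrix a b c $ 1 $ 2 = b"
  "sl2_matrix a b c $ 2 $ 1 = c" "sl2_matrix a b c $ 2 $ 2 = - a"
  by (simp_all add: sl2_matrix_def)

lemma sl2_iff: "A \<in> sl2 \<longleftrightarrow> A $ 2 $ 2 = - A $ 1 $ 1"
  by (auto simp: sl2_def sl2_matrix_def vec_eq_iff forall_2)

lemma sl2_matrix_in_sl2 [simp]: "sl2_matrix a b c \<in> sl2"
  by (auto simp: sl2_def)

lemma sl2_matrix_eq_0_iff: "sl2_matrix a b c = 0 \<longleftrightarrow> a = 0 \<and> b = 0 \<and> c = 0"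
  by (auto simp: vec_eq_iff forall_2)

lemma sl2_quadratic_sl2_matrix [simp]: "sl2_quadratic (sl2_matrix a b c) = a^2 + b * c"
  by (simp add: sl2_quadratic_def)

lemma sl2_polar_sl2_matrix [simp]:
  "sl2_polar (sl2_matrix a b c) (sl2_matrix a' b' c') = 2 * a * a' + b * c' + c * b'"
  by (simp add: sl2_polar_def)

lemma sl2_polar_commute: "sl2_polar A B = sl2_polar B A"
  by (simp add: sl2_polar_def algebra_simps)

lemma matrix_scale_nth [simp]: "matrix_scale s c M $ i $ j = s c (M $ i $ j)"
  by (simp add: matrix_scale_def)

lemma matrix_scale_eq_0_iff:
  fixes M :: "'a::idom^'n^'m"
  shows "matrix_scale (*) c M = 0 \<longleftrightarrow> c = 0 \<or> M = 0"
  by (auto simp: vec_eq_iff)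

lemma commutator_nth_2:
  fixes A B :: "'a::comm_ring_1^2^2"
  shows "commutator A B $ i $ j =
    A $ i $ 1 * B $ 1 $ j + A $ i $ 2 * B $ 2 $ j - B $ i $ 1 * A $ 1 $ j - B $ i $ 2 * A $ 2 $ j"
  by (simp add: commutator_def matrix_matrix_mult_def sum_2)

lemma commutator_sl2_matrix:
  "commutator (sl2_matrix a b c) (sl2_matrix a' b' c') =
     sl2_matrix (b * c' - b' * c) (2 * (a * b' - a' * b)) (2 * (c * a' - c' * a))"
  by (simp add: vec_eq_iff forall_2 commutator_nth_2 algebra_simps)

lemma commutator_swap: "commutator B A = - commutator A B"
  by (simp add: commutator_def)

lemma commutator_in_sl2:
  fixes A B :: "'a::comm_ring_1^2^2"
  shows "commutator A B \<in> sl2"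
  by (simp add: sl2_iff commutator_nth_2 algebra_simps)

lemma commutator_bilinear_2:
  fixes A B C :: "'a::comm_ring_1^2^2"
  shows "commutator (A + B) C = commutator A C + commutator B C"
    and "commutator C (A + B) = commutator C A + commutator C B"
    and "commutator (matrix_scale (*) c A) B = matrix_scale (*) c (commutator A B)"
    and "commutator A (matrix_scale (*) c B) = matrix_scale (*) c (commutator A B)"
  by (simp_all add: vec_eq_iff forall_2 commutator_nth_2 algebra_simps)

text \<open>The left side is \<open>A^2 B - 2 ABA + B A^2\<close>. The Cayley-Hamilton theorem gives \<open>A^2 = q(A)\<close>, and its
  polarization \<open>AB + BA = tr(AB)\<close> gives \<open>ABA = tr(AB) A - q(A) B\<close>.\<close>

lemma double_commutator:
  fixes A B :: "'a::comm_ring_1^2^2"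
  assumes "A \<in> sl2" "B \<in> sl2"
  shows "commutator A (commutator A B) =
    matrix_scale (*) (4 * sl2_quadratic A) B - matrix_scale (*) (2 * sl2_polar A B) A"
  using assms
  by (simp add: sl2_iff vec_eq_iff forall_2 commutator_nth_2 sl2_quadratic_def sl2_polar_def
      power2_eq_square algebra_simps)

text \<open>Because of this identity the Lie bracket alone determines the form: \<open>4 q(A)\<close> is the eigenvalue of
  \<open>(ad A)^2\<close> on the image of \<open>ad A\<close>.\<close>

lemma triple_commutator:
  fixes A B :: "'a::comm_ring_1^2^2"
  assumes A: "A \<in> sl2" and B: "B \<in> sl2"
  shows "commutator A (commutator A (commutator A B)) =
    matrix_scale (*) (4 * sl2_quadratic A) (commutator A B)"
proof -
  have "sl2_polar A (commutator A B) = 0"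
    using A B by (simp add: sl2_iff sl2_polar_def commutator_nth_2 algebra_simps)
  then show ?thesis
    using A by (subst double_commutator) (simp_all add: commutator_in_sl2 vec_eq_iff)
qed

lemma exists_noncommuting_sl2:
  fixes Z :: "'a::idom^2^2"
  assumes "Z \<in> sl2" "Z \<noteq> 0" "(2::'a) \<noteq> 0"
  shows "\<exists>X\<in>sl2. commutator Z X \<noteq> 0"
proof -
  obtain a b c where Z: "Z = sl2_matrix a b c"
    using assms(1) by (auto simp: sl2_def)
  have "commutator Z (sl2_matrix 1 0 0) \<noteq> 0 \<or> commutator Z (sl2_matrix 0 1 0) \<noteq> 0"
    using assms(2,3) by (auto simp: Z commutator_sl2_matrix sl2_matrix_eq_0_iff)
  then show ?thesis
    by (meson sl2_matrix_in_sl2)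
qed

section \<open>Scalars\<close>

context commutative_unital_algebra
begin

lemma scale_eq_embedding_mult: "scl c x = algebra_embedding scl c * x"
  using scale_mult_left[of c 1 x] by (simp add: algebra_embedding_def)

lemma matrix_scale_eq_embedding:
  "matrix_scale scl c M = matrix_scale (*) (algebra_embedding scl c) M"
  by (simp add: vec_eq_iff scale_eq_embedding_mult)

lemma embedding_add [simp]:
  "algebra_embedding scl (x + y) = algebra_embedding scl x + algebra_embedding scl y"
  by (simp add: algebra_embedding_def scale_left_distrib)

lemma embedding_mult [simp]:
  "algebra_embedding scl (x * y) = algebra_embedding scl x * algebra_embedding scl y"
  using scale_scale[of x y 1] scale_eq_embedding_mult[of x "scl y 1"]
  by (simp add: algebra_embedding_def)

lemma embedding_0 [simp]: "algebra_embedding scl 0 = 0"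
  by (simp add: algebra_embedding_def)

lemma embedding_1 [simp]: "algebra_embedding scl 1 = 1"
  by (simp add: algebra_embedding_def)

lemma embedding_diff [simp]:
  "algebra_embedding scl (x - y) = algebra_embedding scl x - algebra_embedding scl y"
  by (simp add: algebra_embedding_def scale_left_diff_distrib)

lemma embedding_minus [simp]:
  "algebra_embedding scl (- x) = - algebra_embedding scl x"
  by (simp add: algebra_embedding_def)

lemma embedding_numeral [simp]: "algebra_embedding scl (numeral n) = numeral n"
  by (induction n) (simp_all only: numeral.simps embedding_add embedding_1)

lemma embedding_eq_0_iff [simp]: "algebra_embedding scl x = 0 \<longleftrightarrow> x = 0"
  by (simp add: algebra_embedding_def)

end

section \<open>Copies of sl2 over a field\<close>

text \<open>A copy of \<open>sl2(F)\<close> is handled through an injective homomorphism onto it. Only its values on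
  trace-zero matrices matter, so all conditions are relative to \<open>sl2\<close>.\<close>

definition sl2_embedding ::
    "('f::field \<Rightarrow> 'a::comm_ring_1 \<Rightarrow> 'a) \<Rightarrow> ('f^2^2 \<Rightarrow> 'a^2^2) \<Rightarrow> bool" where
  "sl2_embedding scl \<phi> \<longleftrightarrow>
     inj_on \<phi> sl2 \<and> \<phi> ` sl2 \<subseteq> sl2 \<and>
     (\<forall>x\<in>sl2. \<forall>y\<in>sl2. \<phi> (x + y) = \<phi> x + \<phi> y) \<and>
     (\<forall>c. \<forall>x\<in>sl2. \<phi> (matrix_scale (*) c x) = matrix_scale scl c (\<phi> x)) \<and>
     (\<forall>x\<in>sl2. \<forall>y\<in>sl2. \<phi> (commutator x y) = commutator (\<phi> x) (\<phi> y))"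

lemma sl2_closed:
  fixes x y :: "'a::comm_ring_1^2^2"
  shows "0 \<in> (sl2 :: ('a^2^2) set)"
    and "x \<in> sl2 \<Longrightarrow> y \<in> sl2 \<Longrightarrow> x + y \<in> sl2"
    and "x \<in> sl2 \<Longrightarrow> matrix_scale (*) c x \<in> sl2"
  by (auto simp: sl2_iff)

lemma (in commutative_unital_algebra) sl2_copy_iff_embedding:
  fixes Z :: "'a^2^2"
  shows "(\<exists>\<aa>. lie_subalgebra (matrix_scale scl) commutator \<aa> sl2 \<and> Z \<in> \<aa> \<and>
              lie_isomorphic (matrix_scale scl) commutator \<aa>
                (matrix_scale (*)) commutator (sl2 :: ('f^2^2) set))
         \<longleftrightarrow> (\<exists>\<phi>. sl2_embedding scl \<phi> \<and> Z \<in> \<phi> ` sl2)"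
    (is "?copy \<longleftrightarrow> ?emb")
proof
  interpret M: vector_space "matrix_scale scl :: 'f \<Rightarrow> 'a^2^2 \<Rightarrow> 'a^2^2"
    by (rule vector_space_matrix_scale) unfold_locales
  show ?emb if ?copy
  proof -
    obtain \<aa> f where sub: "lie_subalgebra (matrix_scale scl) commutator \<aa> (sl2 :: ('a^2^2) set)"
      and Z: "Z \<in> \<aa>" and f: "bij_betw f \<aa> (sl2 :: ('f^2^2) set)"
      and add: "\<And>x y. x \<in> \<aa> \<Longrightarrow> y \<in> \<aa> \<Longrightarrow> f (x + y) = f x + f y"
      and scale: "\<And>c x. x \<in> \<aa> \<Longrightarrow> f (matrix_scale scl c x) = matrix_scale (*) c (f x)"
      and comm: "\<And>x y. x \<in> \<aa> \<Longrightarrow> y \<in> \<aa> \<Longrightarrow> f (commutator x y) = commutator (f x) (f y)"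
      using \<open>?copy\<close> unfolding lie_isomorphic_def by blast
    have \<aa>: "\<aa> \<subseteq> sl2" "M.subspace \<aa>" "\<And>x y. x \<in> \<aa> \<Longrightarrow> y \<in> \<aa> \<Longrightarrow> commutator x y \<in> \<aa>"
      using sub by (auto simp: lie_subalgebra_def)
    define g where "g = inv_into \<aa> f"
    have g: "bij_betw g sl2 \<aa>"
      unfolding g_def by (rule bij_betw_inv_into[OF f])
    have gin: "g x \<in> \<aa>" if "x \<in> sl2" for x
      using g that by (auto dest: bij_betwE)
    have fg: "f (g x) = x" if "x \<in> sl2" for x
      unfolding g_def using f that by (rule bij_betw_inv_into_right)
    have gf: "g (f x) = x" if "x \<in> \<aa>" for x
      unfolding g_def using f that by (rule bij_betw_inv_into_left)
    have "g (x + y) = g x + g y" if "x \<in> sl2" "y \<in> sl2" for x y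
      by (metis that gin fg gf add M.subspace_add[OF \<aa>(2)])
    moreover have "g (matrix_scale (*) c x) = matrix_scale scl c (g x)" if "x \<in> sl2" for c x
      by (metis that gin fg gf scale M.subspace_scale[OF \<aa>(2)])
    moreover have "g (commutator x y) = commutator (g x) (g y)" if "x \<in> sl2" "y \<in> sl2" for x y
      by (metis that gin fg gf comm \<aa>(3))
    moreover have "Z \<in> g ` sl2"
      using g Z by (simp add: bij_betw_def)
    ultimately show ?emb
      using g \<aa>(1) by (auto simp: sl2_embedding_def bij_betw_def intro!: exI[of _ g])
  qed
  show ?copy if ?emb
  proof -
    obtain \<phi> :: "'f^2^2 \<Rightarrow> 'a^2^2" where \<phi>: "sl2_embedding scl \<phi>" and Z: "Z \<in> \<phi> ` sl2"
      using \<open>?emb\<close> by blast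
    have inj: "inj_on \<phi> sl2" and sub: "\<phi> ` sl2 \<subseteq> sl2"
      and add: "\<And>x y. x \<in> sl2 \<Longrightarrow> y \<in> sl2 \<Longrightarrow> \<phi> (x + y) = \<phi> x + \<phi> y"
      and scale: "\<And>c x. x \<in> sl2 \<Longrightarrow> \<phi> (matrix_scale (*) c x) = matrix_scale scl c (\<phi> x)"
      and comm: "\<And>x y. x \<in> sl2 \<Longrightarrow> y \<in> sl2 \<Longrightarrow> \<phi> (commutator x y) = commutator (\<phi> x) (\<phi> y)"
      using \<phi> by (auto simp: sl2_embedding_def)
    have zero: "\<phi> 0 = 0"
      using add[of 0 0] by (simp add: sl2_closed)
    have "M.subspace (\<phi> ` sl2)"
      unfolding M.subspace_def
      using zero sl2_closed(1)
      by (auto simp: add[symmetric] scale[symmetric] sl2_closed intro!: imageI)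
    then have "lie_subalgebra (matrix_scale scl) commutator (\<phi> ` sl2) sl2"
      using sub by (auto simp: lie_subalgebra_def comm[symmetric] commutator_in_sl2)
    moreover have "lie_isomorphic (matrix_scale scl) commutator (\<phi> ` sl2)
        (matrix_scale (*)) commutator (sl2 :: ('f^2^2) set)"
      unfolding lie_isomorphic_def using inj
      by (intro exI[of _ "inv_into sl2 \<phi>"] conjI bij_betw_inv_into)
         (auto simp: bij_betw_def add[symmetric] scale[symmetric] comm[symmetric]
            sl2_closed commutator_in_sl2)
    ultimately show ?copy
      using Z by blast
  qed
qed

lemma (in commutative_unital_algebra) sl2_embedding_zero:
  assumes "sl2_embedding scl \<phi>"
  shows "\<phi> 0 = 0"
proof -
  have "\<phi> (0 + 0) = \<phi> 0 + \<phi> 0"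
    using assms sl2_closed(1) unfolding sl2_embedding_def by blast
  then show ?thesis by simp
qed

text \<open>For some \<open>x\<close>, the commutator \<open>w = [z,x]\<close> is nonzero, and \<open>(ad z)^2\<close> multiplies \<open>w\<close> by \<open>4 q(z)\<close>
  while \<open>(ad (\<phi> z))^2\<close> multiplies \<open>\<phi> w\<close> by \<open>4 q(\<phi> z)\<close>. Since \<open>\<phi> w \<noteq> 0\<close> and the ring is a domain,
  the two factors agree.\<close>

lemma sl2_embedding_quadratic:
  fixes scl :: "'f::field \<Rightarrow> 'a::idom \<Rightarrow> 'a"
  assumes "commutative_unital_algebra scl" and two: "(2::'f) \<noteq> 0"
    and \<phi>: "sl2_embedding scl \<phi>" and z: "z \<in> sl2" "z \<noteq> 0"
  shows "sl2_quadratic (\<phi> z) = algebra_embedding scl (sl2_quadratic z)"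
proof -
  interpret commutative_unital_algebra scl by fact
  let ?\<iota> = "algebra_embedding scl"
  have in_sl2: "\<phi> x \<in> sl2" if "x \<in> sl2" for x
    using \<phi> that by (auto simp: sl2_embedding_def)
  have comm: "\<phi> (commutator x y) = commutator (\<phi> x) (\<phi> y)" if "x \<in> sl2" "y \<in> sl2" for x y
    using \<phi> that by (auto simp: sl2_embedding_def)
  obtain x where x: "x \<in> sl2" and noncomm: "commutator z x \<noteq> 0"
    using exists_noncommuting_sl2 z two by blast
  have nz: "\<phi> (commutator z x) \<noteq> 0"
    using \<phi> noncomm sl2_embedding_zero[OF \<phi>] sl2_closed(1) commutator_in_sl2
    unfolding sl2_embedding_def inj_on_def by metis
  have "matrix_scale (*) (4 * sl2_quadratic (\<phi> z)) (\<phi> (commutator z x)) =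
      \<phi> (commutator z (commutator z (commutator z x)))"
    using triple_commutator[OF in_sl2[OF z(1)] in_sl2[OF x]] z x
    by (simp add: comm commutator_in_sl2)
  also have "\<dots> = matrix_scale (*) (4 * ?\<iota> (sl2_quadratic z)) (\<phi> (commutator z x))"
    using \<phi> commutator_in_sl2[of z x]
    by (subst triple_commutator[OF z(1) x])
       (simp add: sl2_embedding_def matrix_scale_eq_embedding)
  finally have "matrix_scale (*) (4 * sl2_quadratic (\<phi> z) - 4 * ?\<iota> (sl2_quadratic z))
      (\<phi> (commutator z x)) = 0"
    by (simp add: vec_eq_iff algebra_simps)
  then have "4 * (sl2_quadratic (\<phi> z) - ?\<iota> (sl2_quadratic z)) = 0"
    using nz by (simp add: matrix_scale_eq_0_iff algebra_simps)
  moreover have "(4::'a) \<noteq> 0"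
    using two embedding_eq_0_iff[of 2] mult_eq_0_iff[of "2::'a" 2] by simp
  ultimately show ?thesis
    by simp
qed

section \<open>Hyperbolic pairs\<close>

text \<open>The bracket of two combinations of a standard triple has the same coefficients as the bracket of
  the matrices \<open>sl2_matrix a b c\<close> and \<open>sl2_matrix a' b' c'\<close>.\<close>

lemma commutator_of_triple:
  fixes E H Y :: "'a::comm_ring_1^2^2"
  assumes HE: "commutator H E = matrix_scale (*) 2 E"
    and HY: "commutator H Y = matrix_scale (*) (- 2) Y"
    and EY: "commutator E Y = H"
  shows "commutator
      (matrix_scale (*) a H + matrix_scale (*) b E + matrix_scale (*) c Y)
      (matrix_scale (*) a' H + matrix_scale (*) b' E + matrix_scale (*) c' Y) =
    matrix_scale (*) (b * c' - b' * c) H + matrix_scale (*) (2 * (a * b' - a' * b)) E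
      + matrix_scale (*) (2 * (c * a' - c' * a)) Y"
proof -
  have self: "commutator A A = 0" for A :: "'a^2^2"
    by (simp add: commutator_def)
  show ?thesis
    unfolding commutator_bilinear_2 self HE HY EY
      commutator_swap[of E H] commutator_swap[of Y H] commutator_swap[of Y E]
    by (simp add: vec_eq_iff algebra_simps)
qed

text \<open>The relations of a standard triple are the double commutator formula applied to \<open>[E,[E,Y]]\<close> and
  \<open>[Y,[Y,E]]\<close>. The triple is linearly independent because the trace form with \<open>Y\<close> and with \<open>E\<close>
  recovers the coefficients of \<open>E\<close> and \<open>Y\<close>.\<close>

lemma sl2_embedding_of_hyperbolic_pair:
  fixes scl :: "'f::field \<Rightarrow> 'a::idom \<Rightarrow> 'a"
  assumes "commutative_unital_algebra scl" and two: "(2::'f) \<noteq> 0"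
    and E: "E \<in> sl2" "sl2_quadratic E = 0" and Y: "Y \<in> sl2" "sl2_quadratic Y = 0"
    and EY: "sl2_polar E Y = 1"
  shows "\<exists>\<phi>. sl2_embedding scl \<phi> \<and> \<phi> (sl2_matrix 0 1 0) = E \<and>
    (\<forall>c. \<phi> (sl2_matrix c 0 0) = matrix_scale scl c (commutator E Y))"
proof -
  interpret commutative_unital_algebra scl by fact
  let ?\<iota> = "algebra_embedding scl"
  define H where "H = commutator E Y"
  define \<phi> :: "'f^2^2 \<Rightarrow> 'a^2^2" where
    "\<phi> x = matrix_scale (*) (?\<iota> (x $ 1 $ 1)) H + matrix_scale (*) (?\<iota> (x $ 1 $ 2)) E
       + matrix_scale (*) (?\<iota> (x $ 2 $ 1)) Y" for x
  have "(2::'a) \<noteq> 0"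
    using two embedding_eq_0_iff[of 2] by simp
  have H: "H \<in> sl2"
    by (simp add: H_def commutator_in_sl2)
  have HE: "commutator H E = matrix_scale (*) 2 E"
    using double_commutator[OF E(1) Y(1)] E(2) EY
    by (subst commutator_swap) (simp add: H_def vec_eq_iff)
  have HY: "commutator H Y = matrix_scale (*) (- 2) Y"
  proof -
    have "commutator H Y = commutator (- commutator Y E) Y"
      unfolding H_def by (simp only: commutator_swap[of E Y])
    also have "\<dots> = commutator Y (commutator Y E)"
      by (simp add: vec_eq_iff commutator_nth_2[of "- commutator Y E"]
          commutator_nth_2[of _ "commutator Y E"])
    also have "\<dots> = matrix_scale (*) (- 2) Y"
      using double_commutator[OF Y(1) E(1)] Y(2) EY sl2_polar_commute[of Y E]
      by (simp add: vec_eq_iff)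
    finally show ?thesis .
  qed
  have "E \<noteq> 0"
    using EY by (auto simp: sl2_polar_def)
  have polar: "sl2_polar (\<phi> x) Y = ?\<iota> (x $ 1 $ 2)" "sl2_polar (\<phi> x) E = ?\<iota> (x $ 2 $ 1)" for x
  proof -
    have lin: "sl2_polar (\<phi> x) A = ?\<iota> (x $ 1 $ 1) * sl2_polar H A
        + ?\<iota> (x $ 1 $ 2) * sl2_polar E A + ?\<iota> (x $ 2 $ 1) * sl2_polar Y A" for A
      by (simp add: \<phi>_def sl2_polar_def algebra_simps)
    have "sl2_polar A A = 2 * sl2_quadratic A" for A :: "'a^2^2"
      by (simp add: sl2_polar_def sl2_quadratic_def power2_eq_square algebra_simps)
    moreover have "sl2_polar H E = 0" "sl2_polar H Y = 0"
      using E(1) Y(1)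
      by (simp_all add: H_def sl2_polar_def sl2_iff commutator_nth_2 algebra_simps)
    ultimately show "sl2_polar (\<phi> x) Y = ?\<iota> (x $ 1 $ 2)" "sl2_polar (\<phi> x) E = ?\<iota> (x $ 2 $ 1)"
      using E(2) Y(2) EY sl2_polar_commute[of Y E] by (simp_all add: lin)
  qed
  have "H \<noteq> 0"
  proof
    assume "H = 0"
    then have "matrix_scale (*) 2 E = 0"
      using HE by (simp add: commutator_def)
    with \<open>E \<noteq> 0\<close> \<open>(2::'a) \<noteq> 0\<close> show False
      by (simp add: matrix_scale_eq_0_iff)
  qed
  have ker: "x = 0" if "x \<in> sl2" "\<phi> x = 0" for x
  proof -
    have 1: "x $ 1 $ 2 = 0" "x $ 2 $ 1 = 0"
      using polar[of x] that(2) by (simp_all add: sl2_polar_def)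
    then have "matrix_scale (*) (?\<iota> (x $ 1 $ 1)) H = 0"
      using that(2) by (simp add: \<phi>_def vec_eq_iff)
    then have "x $ 1 $ 1 = 0"
      using \<open>H \<noteq> 0\<close> by (simp add: matrix_scale_eq_0_iff)
    with 1 that(1) show ?thesis
      by (simp add: vec_eq_iff forall_2 sl2_iff)
  qed
  have diff: "\<phi> (x - y) = \<phi> x - \<phi> y" for x y
    by (simp add: \<phi>_def vec_eq_iff algebra_simps)
  have "inj_on \<phi> sl2"
  proof (rule inj_onI)
    fix x y :: "'f^2^2" assume "x \<in> sl2" "y \<in> sl2" "\<phi> x = \<phi> y"
    then have "x - y = 0"
      by (intro ker) (simp_all add: diff sl2_iff)
    then show "x = y" by simp
  qed
  moreover have "\<phi> ` sl2 \<subseteq> sl2"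
    using H E(1) Y(1) by (auto simp: \<phi>_def sl2_closed)
  moreover have "\<phi> (x + y) = \<phi> x + \<phi> y" for x y
    by (simp add: \<phi>_def vec_eq_iff algebra_simps)
  moreover have "\<phi> (matrix_scale (*) c x) = matrix_scale scl c (\<phi> x)" for c x
    by (simp add: \<phi>_def vec_eq_iff algebra_simps matrix_scale_eq_embedding)
  moreover have "\<phi> (commutator x y) = commutator (\<phi> x) (\<phi> y)" if "x \<in> sl2" "y \<in> sl2" for x y
    using that
    by (auto simp: sl2_def \<phi>_def commutator_sl2_matrix commutator_of_triple[OF HE HY H_def[symmetric]])
  ultimately have "sl2_embedding scl \<phi>"
    by (simp add: sl2_embedding_def)
  moreover have "\<phi> (sl2_matrix 0 1 0) = E"
    by (simp add: \<phi>_def vec_eq_iff)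
  moreover have "\<phi> (sl2_matrix c 0 0) = matrix_scale scl c (commutator E Y)" for c
    by (simp add: \<phi>_def vec_eq_iff H_def matrix_scale_eq_embedding)
  ultimately show ?thesis
    by blast
qed

section \<open>Elements of quadratic value zero\<close>

text \<open>The matrix \<open>W\<close> with zero diagonal and entries \<open>b\<close>, \<open>a\<close> satisfies \<open>tr(ZW) = 1\<close> and \<open>q(W) = ab\<close>.
  Since \<open>q(W + t Z) = q(W) + t\<close> for isotropic \<open>Z\<close>, subtracting \<open>ab Z\<close> makes \<open>W\<close> isotropic and does
  not change the trace.\<close>

lemma hyperbolic_partner:
  fixes z1 z2 z3 :: "'a::comm_ring_1"
  assumes q: "z1^2 + z2 * z3 = 0" and uni: "z2 * a + z3 * b = 1"
  shows "\<exists>Y\<in>sl2. sl2_quadratic Y = 0 \<and> sl2_polar (sl2_matrix z1 z2 z3) Y = 1"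
proof
  let ?Y = "sl2_matrix (- (a * b * z1)) (b - a * b * z2) (a - a * b * z3)"
  have "sl2_quadratic ?Y = (a * b)^2 * (z1^2 + z2 * z3) + a * b * (1 - (z2 * a + z3 * b))"
    by (simp add: power2_eq_square algebra_simps)
  moreover have "sl2_polar (sl2_matrix z1 z2 z3) ?Y =
      (z2 * a + z3 * b) - 2 * a * b * (z1^2 + z2 * z3)"
    by (simp add: power2_eq_square algebra_simps)
  ultimately show "sl2_quadratic ?Y = 0 \<and> sl2_polar (sl2_matrix z1 z2 z3) ?Y = 1"
    using q uni by simp
qed simp

lemma ideal_sum_eq_UNIV_iff:
  "ideal_sum (principal_ideal x) (principal_ideal y) = UNIV \<longleftrightarrow> (\<exists>a b. x * a + y * b = 1)"
proof
  assume "ideal_sum (principal_ideal x) (principal_ideal y) = UNIV"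
  then have "1 \<in> ideal_sum (principal_ideal x) (principal_ideal y)" by simp
  then show "\<exists>a b. x * a + y * b = 1"
    unfolding ideal_sum_def principal_ideal_def by force
next
  assume "\<exists>a b. x * a + y * b = 1"
  then obtain a b where ab: "x * a + y * b = 1" by blast
  have "r = x * (a * r) + y * (b * r)" for r
    using ab by (metis distrib_right mult.assoc mult_1)
  then show "ideal_sum (principal_ideal x) (principal_ideal y) = UNIV"
    unfolding ideal_sum_def principal_ideal_def by blast
qed

text \<open>Over the field, \<open>z\<close> has a partner \<open>y\<close> with \<open>tr(zy) = 1\<close>, that is, with
  \<open>[z,[z,y]] = - 2 z\<close>. The homomorphism preserves this last equation, and the double commutator formula
  turns it back into a trace relation over the ring.\<close>

lemma unimodular_of_embedding:
  fixes scl :: "'f::field \<Rightarrow> 'a::idom \<Rightarrow> 'a"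
  assumes "commutative_unital_algebra scl" and two: "(2::'f) \<noteq> 0"
    and \<phi>: "sl2_embedding scl \<phi>" and z: "z \<in> sl2" "z \<noteq> 0"
    and \<phi>z: "\<phi> z = sl2_matrix Z1 Z2 Z3" and q: "Z1^2 + Z2 * Z3 = 0"
  shows "\<exists>a b. Z2 * a + Z3 * b = 1"
proof -
  interpret commutative_unital_algebra scl by fact
  have in_sl2: "\<phi> x \<in> sl2" if "x \<in> sl2" for x
    using \<phi> that by (auto simp: sl2_embedding_def)
  have comm: "\<phi> (commutator x y) = commutator (\<phi> x) (\<phi> y)" if "x \<in> sl2" "y \<in> sl2" for x y
    using \<phi> that by (auto simp: sl2_embedding_def)
  have "(2::'a) \<noteq> 0"
    using two embedding_eq_0_iff[of 2] by simp
  obtain z1 z2 z3 where z_eq: "z = sl2_matrix z1 z2 z3"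
    using z(1) by (auto simp: sl2_def)
  have qz: "sl2_quadratic z = 0"
    using sl2_embedding_quadratic[OF assms(1) two \<phi> z] \<phi>z q by simp
  then have "z2 \<noteq> 0 \<or> z3 \<noteq> 0"
    using z(2) by (auto simp: z_eq sl2_matrix_eq_0_iff)
  then have "z2 * inverse z2 + z3 * 0 = 1 \<or> z2 * 0 + z3 * inverse z3 = 1"
    by auto
  then obtain y where y: "y \<in> sl2" "sl2_polar z y = 1"
    using hyperbolic_partner[of z1 z2 z3] qz unfolding z_eq sl2_quadratic_sl2_matrix by metis
  obtain Y1 Y2 Y3 where \<phi>y: "\<phi> y = sl2_matrix Y1 Y2 Y3"
    using in_sl2[OF y(1)] by (auto simp: sl2_def)
  have q\<phi>z: "sl2_quadratic (\<phi> z) = 0"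
    using \<phi>z q by simp
  have "commutator z (commutator z y) = matrix_scale (*) (- 2) z"
    using double_commutator[OF z(1) y(1)] qz y(2) by (simp add: vec_eq_iff)
  then have "commutator (\<phi> z) (commutator (\<phi> z) (\<phi> y)) = matrix_scale scl (- 2) (\<phi> z)"
    using \<phi> z(1) y(1) by (metis comm commutator_in_sl2 sl2_embedding_def)
  moreover have "commutator (\<phi> z) (commutator (\<phi> z) (\<phi> y)) =
      matrix_scale (*) (- (2 * sl2_polar (\<phi> z) (\<phi> y))) (\<phi> z)"
    using double_commutator[OF in_sl2[OF z(1)] in_sl2[OF y(1)]] q\<phi>z by (simp add: vec_eq_iff)
  ultimately have "matrix_scale (*) (2 - 2 * sl2_polar (\<phi> z) (\<phi> y)) (\<phi> z) = 0"
    by (simp add: vec_eq_iff matrix_scale_eq_embedding left_diff_distrib)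
  moreover have "\<phi> z \<noteq> 0"
    using \<phi> z sl2_embedding_zero[OF \<phi>] sl2_closed(1)
    unfolding sl2_embedding_def inj_on_def by metis
  ultimately have "2 * (1 - sl2_polar (\<phi> z) (\<phi> y)) = 0"
    by (simp add: matrix_scale_eq_0_iff algebra_simps)
  with \<open>(2::'a) \<noteq> 0\<close> have "sl2_polar (\<phi> z) (\<phi> y) = 1"
    by (simp only: mult_eq_0_iff) simp
  then have one: "2 * Z1 * Y1 + Z2 * Y3 + Z3 * Y2 = 1"
    by (simp add: \<phi>z \<phi>y)
  have Z1: "Z1^2 = - (Z2 * Z3)"
    using q by (simp add: eq_neg_iff_add_eq_0)
  have "(2 * Z1 * Y1)^2 = 4 * Y1^2 * Z1^2"
    by (simp add: power2_eq_square algebra_simps)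
  then have sq: "(2 * Z1 * Y1)^2 = - (4 * Y1^2 * Z2 * Z3)"
    by (simp add: Z1)
  \<comment> \<open>Both summands lie in the ideal generated by \<open>Z2\<close> and \<open>Z3\<close>.\<close>
  have "1 = (2 * Z1 * Y1)^2 + (1 + 2 * Z1 * Y1) * (1 - 2 * Z1 * Y1)"
    by (simp add: power2_eq_square algebra_simps)
  also have "1 - 2 * Z1 * Y1 = Z2 * Y3 + Z3 * Y2"
    using one by (simp add: algebra_simps)
  finally have "Z2 * ((1 + 2 * Z1 * Y1) * Y3 - 4 * Y1^2 * Z3) + Z3 * ((1 + 2 * Z1 * Y1) * Y2) = 1"
    unfolding sq by (simp add: algebra_simps)
  then show ?thesis
    by blast
qed

section \<open>Elements of quadratic value one\<close>

text \<open>This is the Schreier refinement property: the prime factors of \<open>p\<close> are distributed one by one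
  over \<open>r\<close> and \<open>s\<close>. For a \<open>2 \<times> 2\<close> matrix with entries \<open>p\<close>, \<open>r\<close>, \<open>s\<close>, \<open>q\<close> and determinant zero it
  gives a factorization into a column \<open>(a, d)\<close> and a row \<open>(b, c)\<close>.\<close>

lemma factorial_four_factors:
  fixes p q r s :: "'a::{factorial_semiring, idom}"
  assumes "p * q = r * s"
  shows "\<exists>a b c d. p = a * b \<and> q = c * d \<and> r = a * c \<and> s = b * d"
  using assms
proof (induction p arbitrary: q r s rule: prime_divisors_induct)
  case zero
  then consider "r = 0" | "s = 0" by auto
  then show ?case
  proof cases
    case 1
    then have "0 = 0 * s \<and> q = q * 1 \<and> r = 0 * q \<and> s = s * 1" by simp
    then show ?thesis by blast
  next
    case 2
    then have "0 = r * 0 \<and> q = 1 * q \<and> r = r * 1 \<and> s = 0 * q" by simp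
    then show ?thesis by blast
  qed
next
  case (unit p)
  then obtain p' where "1 = p * p'" by (elim dvdE)
  then have p': "p * p' = 1" by simp
  have "q = (p * p') * q"
    by (simp add: p')
  also have "\<dots> = p' * r * s"
    using unit.prems by (simp add: ac_simps)
  finally have "q = p' * r * s" .
  moreover have "r = p * (p' * r)"
    using p' by (simp flip: mult.assoc)
  ultimately have "p = p * 1 \<and> q = (p' * r) * s \<and> r = p * (p' * r) \<and> s = 1 * s"
    by simp
  then show ?case by blast
next
  case (factor t p)
  have t: "prime_elem t"
    using factor.hyps by (simp add: prime_imp_prime_elem)
  then have "t \<noteq> 0" by auto
  have "t dvd r * s"
    using factor.prems by (metis dvd_triv_left mult.assoc)
  then consider "t dvd r" | "t dvd s"
    using t prime_elem_dvd_multD by blast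
  then show ?case
  proof cases
    case 1
    then obtain r' where r: "r = t * r'" by (elim dvdE)
    then have "p * q = r' * s"
      using factor.prems \<open>t \<noteq> 0\<close> by (simp add: mult.assoc)
    then obtain a b c d where "p = a * b \<and> q = c * d \<and> r' = a * c \<and> s = b * d"
      using factor.IH by blast
    then have "t * p = (t * a) * b \<and> q = c * d \<and> r = (t * a) * c \<and> s = b * d"
      by (simp add: r ac_simps)
    then show ?thesis by blast
  next
    case 2
    then obtain s' where s: "s = t * s'" by (elim dvdE)
    then have "t * (p * q) = t * (r * s')"
      using factor.prems by (simp add: ac_simps)
    then have "p * q = r * s'"
      using \<open>t \<noteq> 0\<close> by simp
    then obtain a b c d where "p = a * b \<and> q = c * d \<and> r = a * c \<and> s' = b * d"
      using factor.IH by blast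
    then have "t * p = a * (t * b) \<and> q = c * d \<and> r = a * c \<and> s = (t * b) * d"
      by (simp add: s ac_simps)
    then show ?thesis by blast
  qed
qed

text \<open>The idempotent \<open>P = (1 + H)/2\<close> has determinant zero and trace 1, so it is a column \<open>(a, d)\<close>
  times a row \<open>(b, c)\<close> with \<open>ab + cd = 1\<close>. The matrix \<open>T\<close> with columns \<open>(a, d)\<close> and \<open>(- c, b)\<close> then has
  determinant 1 and conjugates \<open>diag(1,-1)\<close> to \<open>H\<close>.\<close>

lemma hyperbolic_pair_of_quadratic_one:
  fixes h1 h2 h3 i :: "'a::{factorial_semiring, idom}"
  assumes half: "2 * i = 1" and q: "h1^2 + h2 * h3 = 1"
  shows "\<exists>E\<in>sl2. \<exists>Y\<in>sl2. sl2_quadratic E = 0 \<and> sl2_quadratic Y = 0 \<and> sl2_polar E Y = 1 \<and>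
    commutator E Y = sl2_matrix h1 h2 h3"
proof -
  have "(i * (1 + h1)) * (i * (1 - h1)) = i * i * (1 - h1^2)"
    by (simp add: power2_eq_square algebra_simps)
  also have "1 - h1^2 = h2 * h3"
    using q by (simp add: algebra_simps)
  also have "i * i * (h2 * h3) = (i * h2) * (i * h3)"
    by (simp add: ac_simps)
  finally have prod: "(i * (1 + h1)) * (i * (1 - h1)) = (i * h2) * (i * h3)" .
  obtain a b c d where P: "i * (1 + h1) = a * b" "i * (1 - h1) = c * d"
      "i * h2 = a * c" "i * h3 = b * d"
    using factorial_four_factors[OF prod] by blast
  have two_i: "2 * (i * x) = x" for x
    using half by (simp flip: mult.assoc)
  have one: "a * b + c * d = 1"
    unfolding P[symmetric] using half by (simp add: algebra_simps)
  have "h1 = i * (1 + h1) - i * (1 - h1)"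
    using two_i[of h1] by (simp add: algebra_simps)
  then have h1: "h1 = a * b - c * d"
    unfolding P .
  have h2: "h2 = 2 * (a * c)" and h3: "h3 = 2 * (b * d)"
    using two_i[of h2] two_i[of h3] unfolding P by simp_all
  \<comment> \<open>The conjugates by \<open>T\<close> of the upper and of the lower elementary nilpotent matrix.\<close>
  let ?E = "sl2_matrix (- (a * d)) (a^2) (- (d^2))"
  let ?Y = "sl2_matrix (- (b * c)) (- (c^2)) (b^2)"
  have "sl2_quadratic ?E = 0" "sl2_quadratic ?Y = 0"
    by (simp_all add: power2_eq_square algebra_simps)
  moreover have "sl2_polar ?E ?Y = (a * b + c * d)^2"
    by (simp add: power2_eq_square algebra_simps)
  moreover have "commutator ?E ?Y = sl2_matrix ((a * b + c * d) * (a * b - c * d))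
      (2 * (a * c) * (a * b + c * d)) (2 * (b * d) * (a * b + c * d))"
    by (simp add: commutator_sl2_matrix power2_eq_square algebra_simps)
  ultimately show ?thesis
    using one h1 h2 h3 by (intro bexI[of _ ?E] bexI[of _ ?Y]) simp_all
qed

section \<open>Elements lying in a copy of sl2\<close>

theorem proposition9:
  fixes scl :: "'f::field \<Rightarrow> 'r::{factorial_semiring, idom} \<Rightarrow> 'r"
    and Z :: "'r^2^2" and Z1 Z2 Z3 :: 'r
  assumes "CHAR('f) \<noteq> 2"
    and "\<forall>x::'f. \<exists>y. x = y^2"
    and "commutative_unital_algebra scl"
    and "Z = sl2_matrix Z1 Z2 Z3"
    and "Z \<noteq> 0"
  shows "(\<exists>\<aa>. lie_subalgebra (matrix_scale scl) commutator \<aa> sl2 \<and> Z \<in> \<aa> \<and>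
              lie_isomorphic (matrix_scale scl) commutator \<aa>
                (matrix_scale (*)) commutator (sl2 :: ('f^2^2) set))
         \<longleftrightarrow>
         (if Z1^2 + Z2 * Z3 = 0
          then ideal_sum (principal_ideal Z2) (principal_ideal Z3) = UNIV
          else Z1^2 + Z2 * Z3 \<in> algebra_embedding scl ` (UNIV - {0}))"
    (is "_ \<longleftrightarrow> ?cond")
proof -
  interpret commutative_unital_algebra scl by fact
  let ?\<iota> = "algebra_embedding scl"
  have two: "(2::'f) \<noteq> 0"
  proof
    assume "(2::'f) = 0"
    then have "CHAR('f) dvd 2"
      using of_nat_eq_0_iff_char_dvd[where 'a = 'f and n = 2] by simp
    then have "CHAR('f) = 1"
      using assms(1) two_is_prime_nat by (auto simp: prime_nat_iff)
    then show False
      using of_nat_CHAR[where 'a = 'f] by simp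
  qed
  have "(\<exists>\<phi>. sl2_embedding scl \<phi> \<and> Z \<in> \<phi> ` sl2) \<longleftrightarrow> ?cond"
  proof
    assume "\<exists>\<phi>. sl2_embedding scl \<phi> \<and> Z \<in> \<phi> ` sl2"
    then obtain \<phi> z where \<phi>: "sl2_embedding scl \<phi>" and z: "z \<in> sl2" and Z: "Z = \<phi> z"
      by blast
    have "z \<noteq> 0"
      using sl2_embedding_zero[OF \<phi>] assms(5) Z by auto
    have "Z1^2 + Z2 * Z3 = ?\<iota> (sl2_quadratic z)"
      using sl2_embedding_quadratic[OF assms(3) two \<phi> z \<open>z \<noteq> 0\<close>] Z assms(4)
      by (metis sl2_quadratic_sl2_matrix)
    moreover have "\<exists>a b. Z2 * a + Z3 * b = 1" if "Z1^2 + Z2 * Z3 = 0"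
      using unimodular_of_embedding[OF assms(3) two \<phi> z \<open>z \<noteq> 0\<close> _ that] Z assms(4) by simp
    ultimately show ?cond
      by (auto simp: ideal_sum_eq_UNIV_iff)
  next
    assume cond: ?cond
    show "\<exists>\<phi>. sl2_embedding scl \<phi> \<and> Z \<in> \<phi> ` sl2"
    proof (cases "Z1^2 + Z2 * Z3 = 0")
      case True
      then obtain a b where "Z2 * a + Z3 * b = 1"
        using cond by (auto simp: ideal_sum_eq_UNIV_iff)
      then obtain Y where "Y \<in> sl2" "sl2_quadratic Y = 0" "sl2_polar Z Y = 1"
        using hyperbolic_partner[OF True] assms(4) by blast
      then obtain \<phi> where "sl2_embedding scl \<phi>" "\<phi> (sl2_matrix 0 1 0) = Z"
        using sl2_embedding_of_hyperbolic_pair[OF assms(3) two, of Z Y] True assms(4) by auto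
      then show ?thesis
        by (metis imageI sl2_matrix_in_sl2)
    next
      case False
      then obtain k where k: "Z1^2 + Z2 * Z3 = ?\<iota> k" "k \<noteq> 0"
        using cond by auto
      obtain d where d: "k = d^2"
        using assms(2) by blast
      with k have "d \<noteq> 0" by auto
      \<comment> \<open>Dividing \<open>Z\<close> by \<open>d\<close> gives a matrix of quadratic value 1, which the embedding takes on at
        \<open>diag(1,-1)\<close>; then it takes the value \<open>Z\<close> at \<open>diag(d,-d)\<close>.\<close>
      let ?e = "?\<iota> (inverse d)"
      have de: "?\<iota> d * ?e = 1"
        using \<open>d \<noteq> 0\<close> by (simp del: embedding_mult add: embedding_mult[symmetric])
      have "(?e * Z1)^2 + (?e * Z2) * (?e * Z3) = ?e * ?e * (Z1^2 + Z2 * Z3)"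
        by (simp add: power2_eq_square algebra_simps)
      also have "\<dots> = (?\<iota> d * ?e)^2"
        unfolding k(1) d by (simp add: power2_eq_square ac_simps)
      finally have one: "(?e * Z1)^2 + (?e * Z2) * (?e * Z3) = 1"
        by (simp add: de)
      have half: "2 * ?\<iota> (inverse 2) = 1"
        using two embedding_mult[of 2 "inverse 2"] by simp
      obtain E Y where EY: "E \<in> sl2" "Y \<in> sl2" "sl2_quadratic E = 0" "sl2_quadratic Y = 0"
        "sl2_polar E Y = 1" "commutator E Y = sl2_matrix (?e * Z1) (?e * Z2) (?e * Z3)"
        using hyperbolic_pair_of_quadratic_one[OF half one] by blast
      obtain \<phi> where \<phi>: "sl2_embedding scl \<phi>"
        "\<And>c. \<phi> (sl2_matrix c 0 0) = matrix_scale scl c (commutator E Y)"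
        using sl2_embedding_of_hyperbolic_pair[OF assms(3) two EY(1,3,2,4,5)] by blast
      have "\<phi> (sl2_matrix d 0 0) = Z"
        unfolding \<phi>(2) EY(6) assms(4) matrix_scale_eq_embedding
        by (simp add: vec_eq_iff forall_2 mult.assoc[symmetric] de del: embedding_mult)
      with \<phi>(1) show ?thesis
        by (metis imageI sl2_matrix_in_sl2)
    qed
  qed
  then show ?thesis
    by (simp only: sl2_copy_iff_embedding)
qed

end
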